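(* Let $\lambda\in\mathbb{R}$ be a constant. The Lie point symmetries of the equation $$u_t-u_{txx}+\lambda(u-u_{xx})+3u^2u_x=uu_{xxx}+2u_xu_{xx}$$ are generated by the operators $$X_1=\frac{\partial}{\partial t},\qquad X_2=\frac{\partial}{\partial x},$$ which correspond to translations in $t$ and $x$, respectively.
   Context: Independent variables $(t,x)$, dependent variable $u$. A differential function is a smooth function of $(t,x,u)$ and finitely many derivatives of $u$; $D_t$ and $D_x$ denote the total derivatives. A one-parameter group of transformations of $(t,x,u)$-space with infinitesimal generator $X=\tau\frac{\partial}{\partial t}+\xi\frac{\partial}{\partial x}+\eta\frac{\partial}{\partial u}$, where $\tau,\xi,\eta$ are smooth functions of $(t,x,u)$ only, is a Lie point symmetry of the equation $F=0$ with $F:=u_t-u_{txx}+\lambda(u-u_{xx})-uu_{xxx}-2u_xu_{xx}+3u^2u_x$ if and only if $X^{(3)}F=0$ whenever $F=0$ (equivalently, $X^{(3)}F=\mu F$ for some differential function $\mu$). Here $X^{(3)}$ is the third-order prolongation of $X$, whose relevant components are $X^{(3)}=X+\zeta^t\partial_{u_t}+\zeta^x\partial_{u_x}+\zeta^{xx}\partial_{u_{xx}}+\zeta^{xxx}\partial_{u_{xxx}}+\zeta^{txx}\partial_{u_{txx}}$, given by the usual prolongation formulas (e.g. $\zeta^t=D_t\eta-(D_t\tau)u_t-(D_t\xi)u_x$, $\zeta^x=D_x\eta-(D_x\tau)u_t-(D_x\xi)u_x$, $\zeta^{xx}=D_x\zeta^x-(D_x\tau)u_{xt}-(D_x\xi)u_{xx}$,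 and so on). "Generated by $X_1,X_2$" means that the infinitesimal generators of Lie point symmetries are exactly the linear combinations of $X_1$ and $X_2$ with constant coefficients. *)

theory Defs
  imports "HOL-Analysis.Analysis" "HOL-Library.Groups_Big_Fun"
begin

section \<open>Smooth maps\<close>

primrec Ck :: "nat \<Rightarrow> ('a::euclidean_space \<Rightarrow> 'b::real_normed_vector) \<Rightarrow> bool" where
  "Ck 0 f \<longleftrightarrow> continuous_on UNIV f"
| "Ck (Suc n) f \<longleftrightarrow> (\<forall>p. f differentiable (at p)) \<and>
     (\<forall>v. Ck n (\<lambda>p. frechet_derivative f (at p) v))"

definition smooth :: "('a::euclidean_space \<Rightarrow> 'b::real_normed_vector) \<Rightarrow> bool" where
  "smooth f \<longleftrightarrow> (\<forall>n. Ck n f)"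


section \<open>Jet coordinates and total derivatives\<close>

text \<open>\<open>Ju i j\<close> is the coordinate of the derivative of \<open>u\<close> taken \<open>i\<close> times in \<open>t\<close> and
  \<open>j\<close> times in \<open>x\<close>; in particular \<open>Ju 0 0\<close> is \<open>u\<close> itself.\<close>

datatype jcoord = Jt | Jx | Ju nat nat

type_synonym jet = "jcoord \<Rightarrow> real"

type_synonym dfun = "jet \<Rightarrow> real"

definition pd :: "jcoord \<Rightarrow> dfun \<Rightarrow> dfun" where
  "pd c f z = deriv (\<lambda>s. f (z(c := s))) (z c)"

text \<open>A differential function depends on finitely many coordinates only, so the sums below
  have finite support and \<^const>\<open>Sum_any\<close> is their actual value.\<close>

definition Dt :: "dfun \<Rightarrow> dfun" where
  "Dt f z = pd Jt f z + Sum_any (\<lambda>(i, j). z (Ju (Suc i) j) * pd (Ju i j) f z)"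

definition Dx :: "dfun \<Rightarrow> dfun" where
  "Dx f z = pd Jx f z + Sum_any (\<lambda>(i, j). z (Ju i (Suc j)) * pd (Ju i j) f z)"


section \<open>Vector fields on the space of \<open>(t, x, u)\<close> and their prolongations\<close>

text \<open>The vector field \<open>\<tau> \<partial>\<^sub>t + \<xi> \<partial>\<^sub>x + \<eta> \<partial>\<^sub>u\<close> is the map
  \<open>p \<mapsto> (\<tau> p, \<xi> p, \<eta> p)\<close>.\<close>

type_synonym point = "real \<times> real \<times> real"

type_synonym vfield = "point \<Rightarrow> point"

definition base :: "jet \<Rightarrow> point" where
  "base z = (z Jt, z Jx, z (Ju 0 0))"

definition tau :: "vfield \<Rightarrow> dfun" where
  "tau X z = fst (X (base z))"

definition xi :: "vfield \<Rightarrow> dfun" where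
  "xi X z = fst (snd (X (base z)))"

definition eta :: "vfield \<Rightarrow> dfun" where
  "eta X z = snd (snd (X (base z)))"

text \<open>\<open>zeta X i j\<close> is the coefficient of \<open>\<partial> / \<partial> (Ju i j)\<close>; the \<open>t\<close>-derivatives are
  taken first, e.g. the coefficient for \<open>u\<^sub>t\<^sub>x\<^sub>x\<close> arises from \<open>\<zeta>\<^sup>t\<close> by two \<open>x\<close>-steps.\<close>

fun zeta :: "vfield \<Rightarrow> nat \<Rightarrow> nat \<Rightarrow> dfun" where
  "zeta X 0 0 = eta X"
| "zeta X (Suc i) 0 = (\<lambda>z. Dt (zeta X i 0) z
     - Dt (tau X) z * z (Ju (Suc i) 0) - Dt (xi X) z * z (Ju i 1))"
| "zeta X i (Suc j) = (\<lambda>z. Dx (zeta X i j) z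
     - Dx (tau X) z * z (Ju (Suc i) j) - Dx (xi X) z * z (Ju i (Suc j)))"

definition prolong :: "nat \<Rightarrow> vfield \<Rightarrow> dfun \<Rightarrow> dfun" where
  "prolong n X f z = tau X z * pd Jt f z + xi X z * pd Jx f z
     + (\<Sum>(i, j) | i + j \<le> n. zeta X i j z * pd (Ju i j) f z)"


section \<open>The equation and its Lie point symmetries\<close>

definition eqF :: "real \<Rightarrow> dfun" where
  "eqF lam z =
     (let u = z (Ju 0 0); u_t = z (Ju 1 0); u_x = z (Ju 0 1); u_xx = z (Ju 0 2);
          u_xxx = z (Ju 0 3); u_txx = z (Ju 1 2)
      in u_t - u_txx + lam * (u - u_xx) - u * u_xxx - 2 * u_x * u_xx + 3 * u\<^sup>2 * u_x)"

definition lie_point_symmetry_generator :: "real \<Rightarrow> vfield \<Rightarrow> bool" where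
  "lie_point_symmetry_generator lam X \<longleftrightarrow>
     smooth X \<and> (\<forall>z. eqF lam z = 0 \<longrightarrow> prolong 3 X (eqF lam) z = 0)"

definition X1 :: vfield where
  "X1 = (\<lambda>p. (1, 0, 0))"

definition X2 :: vfield where
  "X2 = (\<lambda>p. (0, 1, 0))"

definition one_parameter_group :: "(real \<Rightarrow> point \<Rightarrow> point) \<Rightarrow> vfield \<Rightarrow> bool" where
  "one_parameter_group \<phi> X \<longleftrightarrow>
     smooth (\<lambda>(a, p). \<phi> a p) \<and>
     (\<forall>p. \<phi> 0 p = p) \<and>
     (\<forall>a b p. \<phi> (a + b) p = \<phi> a (\<phi> b p)) \<and>
     (\<forall>p. ((\<lambda>a. \<phi> a p) has_vector_derivative X p) (at 0))"

end

theory Submission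
  imports Defs
begin

text \<open>Write \<open>X = \<tau> \<partial>\<^sub>t + \<xi> \<partial>\<^sub>x + \<eta> \<partial>\<^sub>u\<close>. The equation \<open>F = 0\<close> can be solved for \<open>u\<^sub>t\<^sub>x\<^sub>x\<close>, so all other
jet coordinates are free on it. The symmetry condition, that the third prolongation of \<open>X\<close>
annihilates \<open>F\<close> there, is thus a polynomial identity in these coordinates, with coefficients
depending on \<open>(t, x, u)\<close>, and can be split into its coefficients. That needs the prolongation
coefficients in closed form. The total derivatives are derivations on differential functions
(\<open>total_deriv_mult\<close>), so each of them follows from the Leibniz rule (\<open>zeta_xxx\<close>, \<open>zeta_txx\<close>).

Only a few of the resulting determining equations are used, because three families of jets, in
each of which all but at most two of the free derivatives of \<open>u\<close> vanish, suffice: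

\<^item> The coordinate \<open>u\<^sub>t\<^sub>t\<^sub>x\<close> enters only through \<open>2 D\<^sub>x\<tau> u\<^sub>t\<^sub>t\<^sub>x\<close>. Hence \<open>D\<^sub>x\<tau> = 0\<close>, and \<open>\<tau>\<close> depends on
  \<open>t\<close> alone (\<open>tau_time_only\<close>).

\<^item> The coefficients of \<open>u\<^sub>t u\<^sub>x\<^sub>x\<^sub>x\<close>, \<open>u\<^sub>x\<^sub>x\<^sub>x\<close> and \<open>u\<^sub>t\<close> give \<open>\<xi>\<^sub>u = 0\<close>, \<open>\<eta> = \<xi>\<^sub>t + u (\<xi>\<^sub>x - \<tau>\<^sub>t)\<close> and
  \<open>\<eta>\<^sub>x\<^sub>x\<^sub>u = 2 \<xi>\<^sub>x\<close>. From here on, all dependence on \<open>u\<close> is explicit.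

\<^item> The coefficient of \<open>u\<^sub>x\<close> is a quadratic polynomial in \<open>u\<close>. Its leading coefficient gives
  \<open>3 \<xi>\<^sub>x = \<tau>\<^sub>t\<close>, and the linear one expresses \<open>\<xi>\<^sub>t\<close> through \<open>x\<close>-derivatives of \<open>\<xi>\<^sub>x\<close> and \<open>\<eta>\<^sub>u\<close>.

Now \<open>\<xi>\<^sub>x\<close> is a function of \<open>t\<close> alone, and so is \<open>\<eta>\<^sub>u = \<xi>\<^sub>x - \<tau>\<^sub>t\<close>. Thus \<open>2 \<xi>\<^sub>x = \<eta>\<^sub>x\<^sub>x\<^sub>u = 0\<close>, then \<open>\<tau>\<^sub>t = 0\<close> and
\<open>\<xi>\<^sub>t = 0\<close>, and finally \<open>\<eta> = 0\<close>. The relation \<open>3 \<xi>\<^sub>x = \<tau>\<^sub>t\<close> stems from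
the term \<open>3 u\<^sup>2 u\<^sub>x\<close> of the equation, without which the scaling \<open>t \<partial>\<^sub>t - u \<partial>\<^sub>u\<close> would be a further
symmetry for \<open>\<lambda> = 0\<close>.

Conversely, all prolongation coefficients of a constant field without \<open>u\<close>-component vanish, and
\<open>F\<close> does not involve \<open>t\<close> and \<open>x\<close>.\<close>

section \<open>Smooth functions and directional derivatives\<close>

definition dir_deriv :: "'a::euclidean_space \<Rightarrow> ('a \<Rightarrow> real) \<Rightarrow> 'a \<Rightarrow> real" where
  "dir_deriv v f p = frechet_derivative f (at p) v"

lemma Ck_const: "Ck n (\<lambda>p. c)"
  by (induction n arbitrary: c) (simp_all add: frechet_derivative_const)

lemma Ck_bounded_linear_comp:
  assumes "bounded_linear g" "Ck n f"
  shows "Ck n (\<lambda>p. g (f p))"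
  using assms(2)
proof (induction n arbitrary: f)
  case 0
  then show ?case
    using assms(1) by (auto intro!: linear_continuous_on_compose simp: linear_linear bounded_linear.continuous_on)
next
  case (Suc n)
  have "((\<lambda>p. g (f p)) has_derivative (\<lambda>v. g (frechet_derivative f (at p) v))) (at p)" for p
    using Suc.prems by (intro bounded_linear.has_derivative[OF assms(1)])
      (auto simp: frechet_derivative_works)
  then have "(\<lambda>p. g (f p)) differentiable (at p)"
    "frechet_derivative (\<lambda>p. g (f p)) (at p) = (\<lambda>v. g (frechet_derivative f (at p) v))" for p
    by (blast intro: differentiableI, metis frechet_derivative_at)
  then show ?case
    using Suc by simp
qed

lemma smooth_bounded_linear_comp: "bounded_linear g \<Longrightarrow> smooth f \<Longrightarrow> smooth (\<lambda>p. g (f p))"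
  by (simp add: smooth_def Ck_bounded_linear_comp)

lemma smooth_const: "smooth (\<lambda>p. c)"
  by (simp add: smooth_def Ck_const)

lemma smooth_diff:
  assumes "smooth f" "smooth g"
  shows "smooth (\<lambda>p. f p - g p)"
proof -
  have "Ck n (\<lambda>p. f p - g p)" if "Ck n f" "Ck n g" for n
    using that
  proof (induction n arbitrary: f g)
    case 0
    then show ?case by (simp add: continuous_on_diff)
  next
    case (Suc n)
    then have "((\<lambda>p. f p - g p) has_derivative
        (\<lambda>v. frechet_derivative f (at p) v - frechet_derivative g (at p) v)) (at p)" for p
      by (intro has_derivative_diff) (simp_all add: frechet_derivative_works[symmetric])
    then have "frechet_derivative (\<lambda>p. f p - g p) (at p) =
        (\<lambda>v. frechet_derivative f (at p) v - frechet_derivative g (at p) v)" for p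
      by (metis frechet_derivative_at)
    then show ?case
      using Suc by simp
  qed
  then show ?thesis
    using assms by (simp add: smooth_def)
qed

lemma smooth_bounded_linear:
  assumes "bounded_linear g"
  shows "smooth g"
proof -
  have d: "(g has_derivative g) (at p)" for p
    by (rule bounded_linear_imp_has_derivative[OF assms])
  then have "g differentiable (at p)" "frechet_derivative g (at p) = g" for p
    by (blast intro: differentiableI, metis frechet_derivative_at)
  then have "Ck n g" for n
    by (cases n) (simp_all add: Ck_const linear_continuous_on[OF assms])
  then show ?thesis by (simp add: smooth_def)
qed

lemma smooth_differentiable: "smooth f \<Longrightarrow> f differentiable (at p)"
  unfolding smooth_def by (metis Ck.simps(2))

lemma smooth_dir_deriv: "smooth f \<Longrightarrow> smooth (dir_deriv v f)"
  unfolding smooth_def dir_deriv_def by (metis Ck.simps(2))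

lemma has_derivative_dir_deriv:
  "smooth f \<Longrightarrow> (f has_derivative (\<lambda>v. dir_deriv v f p)) (at p)"
  using smooth_differentiable[of f p] by (simp add: dir_deriv_def frechet_derivative_works[symmetric])

lemma has_derivative_imp_dir_deriv: "(f has_derivative f') (at p) \<Longrightarrow> dir_deriv v f p = f' v"
  by (simp add: dir_deriv_def frechet_derivative_at[symmetric])

lemma smooth_line_derivative:
  assumes "smooth f"
  shows "((\<lambda>s. f (p + s *\<^sub>R v)) has_real_derivative dir_deriv v f (p + s *\<^sub>R v)) (at s)"
proof -
  have "((\<lambda>s. f (p + s *\<^sub>R v)) has_derivative (\<lambda>h. dir_deriv (h *\<^sub>R v) f (p + s *\<^sub>R v))) (at s)"
    by (rule has_derivative_compose[OF _ has_derivative_dir_deriv[OF assms]])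
      (auto intro!: derivative_eq_intros)
  moreover have "dir_deriv (h *\<^sub>R v) f q = h * dir_deriv v f q" for h q
    using has_derivative_dir_deriv[OF assms, of q]
    by (metis has_derivative_linear linear_cmul real_scaleR_def)
  ultimately show ?thesis
    by (simp add: has_field_derivative_def mult.commute[of _ "dir_deriv v f _"])
qed

lemma translation_invariant:
  assumes "smooth f" "dir_deriv v f = (\<lambda>p. 0)"
  shows "f (p + s *\<^sub>R v) = f p"
proof -
  have "((\<lambda>s. f (p + s *\<^sub>R v)) has_real_derivative 0) (at s)" for s
    using smooth_line_derivative[OF assms(1), of p v s] by (simp add: assms(2))
  then have "f (p + s *\<^sub>R v) = f (p + 0 *\<^sub>R v)"
    by (intro DERIV_isconst_all) simp
  then show ?thesis by simp
qed

text \<open>A function whose derivative along \<open>v\<close> vanishes is invariant under translation along \<open>v\<close>, and its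
other derivatives inherit this invariance. With this fact no mixed derivatives ever
have to be interchanged.\<close>

lemma dir_deriv_dir_deriv_eq_0:
  assumes "smooth f" "dir_deriv v f = (\<lambda>p. 0)"
  shows "dir_deriv v (dir_deriv w f) = (\<lambda>p. 0)"
proof
  fix p
  have inv: "dir_deriv w f (p + s *\<^sub>R v) = dir_deriv w f p" for s
  proof -
    have "((\<lambda>q. f (q + s *\<^sub>R v)) has_derivative (\<lambda>h. dir_deriv h f (p + s *\<^sub>R v))) (at p)"
      by (rule has_derivative_compose[OF _ has_derivative_dir_deriv[OF assms(1)]])
        (auto intro!: derivative_eq_intros)
    then have "(f has_derivative (\<lambda>h. dir_deriv h f (p + s *\<^sub>R v))) (at p)"
      by (simp add: translation_invariant[OF assms])
    then show ?thesis by (simp add: has_derivative_imp_dir_deriv)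
  qed
  have "((\<lambda>s. dir_deriv w f (p + s *\<^sub>R v)) has_real_derivative
      dir_deriv v (dir_deriv w f) (p + 0 *\<^sub>R v)) (at 0)"
    by (rule smooth_line_derivative[OF smooth_dir_deriv[OF assms(1)]])
  then show "dir_deriv v (dir_deriv w f) p = 0"
    by (simp add: inv) (metis DERIV_const DERIV_unique)
qed

lemma dir_deriv_diff: "smooth f \<Longrightarrow> smooth g \<Longrightarrow> dir_deriv v (\<lambda>p. f p - g p) =
    (\<lambda>p. dir_deriv v f p - dir_deriv v g p)"
  by (rule ext, rule has_derivative_imp_dir_deriv) (intro has_derivative_diff has_derivative_dir_deriv)

lemma dir_deriv_cmult: "smooth f \<Longrightarrow> dir_deriv v (\<lambda>p. c * f p) = (\<lambda>p. c * dir_deriv v f p)"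
  by (rule ext, rule has_derivative_imp_dir_deriv) (intro has_derivative_mult_right has_derivative_dir_deriv)

lemma dir_deriv_const: "dir_deriv v (\<lambda>p. c) = (\<lambda>p. 0)"
  by (rule ext) (simp add: dir_deriv_def frechet_derivative_const)

abbreviation dT :: "(point \<Rightarrow> real) \<Rightarrow> point \<Rightarrow> real" where "dT \<equiv> dir_deriv (1, 0, 0)"
abbreviation dX :: "(point \<Rightarrow> real) \<Rightarrow> point \<Rightarrow> real" where "dX \<equiv> dir_deriv (0, 1, 0)"
abbreviation dU :: "(point \<Rightarrow> real) \<Rightarrow> point \<Rightarrow> real" where "dU \<equiv> dir_deriv (0, 0, 1)"

lemma gradient_0_imp_const:
  assumes "smooth f" "dT f = (\<lambda>p. 0)" "dX f = (\<lambda>p. 0)" "dU f = (\<lambda>p. 0)"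
  shows "f p = f q"
proof -
  have "f (t, x, u) = f (0, 0, 0)" for t x u :: real
    using translation_invariant[OF assms(1,2), of "(0, x, u)" t]
      translation_invariant[OF assms(1,3), of "(0, 0, u)" x]
      translation_invariant[OF assms(1,4), of "(0, 0, 0)" u]
    by simp
  then show ?thesis by (metis prod_cases3)
qed

text \<open>All points of a \<open>u\<close>-line are referred to \<open>u = 0\<close>, so that the coefficients of a polynomial in
\<open>u\<close> can be compared by evaluating it at several points.\<close>

lemma independent_of_u:
  assumes "smooth f" "dU f = (\<lambda>p. 0)"
  shows "f (t, x, u) = f (t, x, 0 :: real)"
  using translation_invariant[OF assms, of "(t, x, 0)" u] by simp

lemma dir_deriv_affine_in_u:
  fixes f g :: "point \<Rightarrow> real"
  assumes "smooth f" "smooth g"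
  shows "dir_deriv v (\<lambda>p. f p + snd (snd p) * g p) =
    (\<lambda>p. dir_deriv v f p + snd (snd p) * dir_deriv v g p + snd (snd v) * g p)"
proof
  fix p
  have "((\<lambda>p. f p + snd (snd p) * g p) has_derivative
      (\<lambda>h. dir_deriv h f p + (snd (snd p) * dir_deriv h g p + snd (snd h) * g p))) (at p)"
    by (intro has_derivative_add has_derivative_mult has_derivative_dir_deriv assms has_derivative_snd
        has_derivative_ident)
  then show "dir_deriv v (\<lambda>p. f p + snd (snd p) * g p) p =
      dir_deriv v f p + snd (snd p) * dir_deriv v g p + snd (snd v) * g p"
    by (simp add: has_derivative_imp_dir_deriv)
qed

section \<open>Total derivatives as derivations\<close>

text \<open>This is what the derivation rules rest on: dependence on finitely many coordinates makes the sums
in the total derivatives finite, and differentiability in each coordinate separately gives the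
sum and product rules for every summand.\<close>

definition differential_function :: "dfun \<Rightarrow> bool" where
  "differential_function f \<longleftrightarrow>
     (\<exists>S. finite S \<and> (\<forall>c z s. c \<notin> S \<longrightarrow> f (z(c := s)) = f z)) \<and>
     (\<forall>c z. (\<lambda>s. f (z(c := s))) differentiable (at (z c)))"

lemma pd_works:
  "differential_function f \<Longrightarrow> ((\<lambda>s. f (z(c := s))) has_real_derivative pd c f z) (at (z c))"
  unfolding differential_function_def pd_def
  by (metis real_differentiable_def DERIV_imp_deriv)

lemma pdI: "((\<lambda>s. f (z(c := s))) has_real_derivative d) (at (z c)) \<Longrightarrow> pd c f z = d"
  by (simp add: pd_def DERIV_imp_deriv)

lemma differential_function_add:
  assumes "differential_function f" "differential_function g"
  shows "differential_function (\<lambda>z. f z + g z)"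
proof -
  obtain S T where "finite S" "\<forall>c z s. c \<notin> S \<longrightarrow> f (z(c := s)) = f z"
    "finite T" "\<forall>c z s. c \<notin> T \<longrightarrow> g (z(c := s)) = g z"
    using assms unfolding differential_function_def by blast
  then show ?thesis
    using assms unfolding differential_function_def
    by (auto intro!: exI[of _ "S \<union> T"])
qed

lemma differential_function_mult:
  assumes "differential_function f" "differential_function g"
  shows "differential_function (\<lambda>z. f z * g z)"
proof -
  obtain S T where "finite S" "\<forall>c z s. c \<notin> S \<longrightarrow> f (z(c := s)) = f z"
    "finite T" "\<forall>c z s. c \<notin> T \<longrightarrow> g (z(c := s)) = g z"
    using assms unfolding differential_function_def by blast
  then show ?thesis
    using assms unfolding differential_function_def
    by (auto intro!: exI[of _ "S \<union> T"])
qed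

lemma differential_function_const: "differential_function (\<lambda>z. a)"
  by (auto simp: differential_function_def intro: exI[of _ "{}"])

lemma differential_function_coord: "differential_function (\<lambda>z. z c)"
proof -
  have "(\<lambda>s. (z(b := s)) c) differentiable at (z b)" for z :: jet and b
    by (cases "c = b") auto
  then show ?thesis
    by (auto simp: differential_function_def intro: exI[of _ "{c}"])
qed

lemma differential_function_diff:
  assumes "differential_function f" "differential_function g"
  shows "differential_function (\<lambda>z. f z - g z)"
  using differential_function_add[OF assms(1)
      differential_function_mult[OF differential_function_const[of "-1"] assms(2)]]
  by simp

definition lift :: "(point \<Rightarrow> real) \<Rightarrow> dfun" where
  "lift f z = f (base z)"

lemma lift_has_derivative:
  assumes "smooth f"
  shows "((\<lambda>s. lift f (z(Jt := s))) has_real_derivative dT f (base z)) (at (z Jt))"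
    "((\<lambda>s. lift f (z(Jx := s))) has_real_derivative dX f (base z)) (at (z Jx))"
    "((\<lambda>s. lift f (z(Ju 0 0 := s))) has_real_derivative dU f (base z)) (at (z (Ju 0 0)))"
  using smooth_line_derivative[OF assms, of "(0, z Jx, z (Ju 0 0))" "(1,0,0)" "z Jt"]
    smooth_line_derivative[OF assms, of "(z Jt, 0, z (Ju 0 0))" "(0,1,0)" "z Jx"]
    smooth_line_derivative[OF assms, of "(z Jt, z Jx, 0)" "(0,0,1)" "z (Ju 0 0)"]
  by (simp_all add: lift_def base_def)

lemma lift_unaffected: "c \<notin> {Jt, Jx, Ju 0 0} \<Longrightarrow> lift f (z(c := s)) = lift f z"
  by (auto simp: lift_def base_def)

lemma differential_function_lift:
  assumes "smooth f"
  shows "differential_function (lift f)"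
proof -
  have "(\<lambda>s. lift f (z(c := s))) differentiable (at (z c))" for c z
  proof (cases "c \<in> {Jt, Jx, Ju 0 0}")
    case True
    then show ?thesis
      using lift_has_derivative[OF assms, of z] by (auto simp: real_differentiable_def)
  next
    case False
    then show ?thesis by (simp add: lift_unaffected)
  qed
  then show ?thesis
    unfolding differential_function_def
    by (auto intro!: exI[of _ "{Jt, Jx, Ju 0 0}"] simp: lift_unaffected)
qed

lemmas differential_function_intros =
  differential_function_add differential_function_diff differential_function_mult
  differential_function_const differential_function_coord differential_function_lift

lemma pd_add: "differential_function f \<Longrightarrow> differential_function g \<Longrightarrow>
    pd c (\<lambda>z. f z + g z) z = pd c f z + pd c g z"
  by (rule pdI) (intro DERIV_add pd_works)

lemma pd_mult: "differential_function f \<Longrightarrow> differential_function g \<Longrightarrow>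
    pd c (\<lambda>z. f z * g z) z = pd c f z * g z + f z * pd c g z"
  using DERIV_mult[OF pd_works[of f z c] pd_works[of g z c]] by (intro pdI) (simp add: algebra_simps)

lemma pd_const: "pd c (\<lambda>z. a) z = 0"
  by (simp add: pd_def)

lemma pd_coord: "pd b (\<lambda>z. z c) z = (if b = c then 1 else 0)"
  by (simp add: pd_def)

lemma pd_lift:
  assumes "smooth f"
  shows "pd Jt (lift f) z = lift (dT f) z" "pd Jx (lift f) z = lift (dX f) z"
    "pd (Ju i j) (lift f) z = (if i = 0 \<and> j = 0 then lift (dU f) z else 0)"
proof -
  show "pd Jt (lift f) z = lift (dT f) z" "pd Jx (lift f) z = lift (dX f) z"
    using lift_has_derivative[OF assms, of z] by (auto simp: lift_def[of "dir_deriv _ _"] intro: pdI)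
  have "pd (Ju 0 0) (lift f) z = lift (dU f) z"
    using lift_has_derivative(3)[OF assms, of z] by (auto simp: lift_def[of "dir_deriv _ _"] intro: pdI)
  moreover have "pd (Ju i j) (lift f) z = 0" if "Ju i j \<notin> {Jt, Jx, Ju 0 0}"
    unfolding pd_def lift_unaffected[OF that] by simp
  ultimately show "pd (Ju i j) (lift f) z = (if i = 0 \<and> j = 0 then lift (dU f) z else 0)"
    by auto
qed

lemma finite_pd_support:
  assumes "differential_function f"
  shows "finite {(i, j). a i j * pd (Ju i j) f z \<noteq> 0}"
proof -
  obtain S where S: "finite S" "\<forall>c z s. c \<notin> S \<longrightarrow> f (z(c := s)) = f z"
    using assms unfolding differential_function_def by blast
  have "pd c f z = 0" if "c \<notin> S" for c
    using S(2) that by (simp add: pd_def)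
  then have "(\<lambda>(i, j). Ju i j) ` {(i, j). a i j * pd (Ju i j) f z \<noteq> 0} \<subseteq> S"
    by auto
  then have "finite ((\<lambda>(i, j). Ju i j) ` {(i, j). a i j * pd (Ju i j) f z \<noteq> 0})"
    using S(1) finite_subset by blast
  then show ?thesis
    by (rule finite_imageD) (auto simp: inj_on_def)
qed

text \<open>The common shape of both total derivatives: \<open>b\<close> is the independent variable and \<open>\<sigma>\<close> raises the
order of a derivative of \<open>u\<close> in it.\<close>

definition total_deriv :: "jcoord \<Rightarrow> (nat \<Rightarrow> nat \<Rightarrow> jcoord) \<Rightarrow> dfun \<Rightarrow> dfun" where
  "total_deriv b \<sigma> f z = pd b f z + Sum_any (\<lambda>(i, j). z (\<sigma> i j) * pd (Ju i j) f z)"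

lemma total_deriv_eq: "Dt = total_deriv Jt (\<lambda>i j. Ju (Suc i) j)" "Dx = total_deriv Jx (\<lambda>i j. Ju i (Suc j))"
  by (intro ext, simp add: Dt_def Dx_def total_deriv_def)+

lemma total_deriv_add:
  assumes "differential_function f" "differential_function g"
  shows "total_deriv b \<sigma> (\<lambda>z. f z + g z) = (\<lambda>z. total_deriv b \<sigma> f z + total_deriv b \<sigma> g z)"
proof
  fix z :: jet
  let ?S = "\<lambda>h (i, j). z (\<sigma> i j) * pd (Ju i j) h z"
  have fin: "finite {ij. ?S h ij \<noteq> 0}" if "differential_function h" for h
    using finite_pd_support[OF that, of "\<lambda>i j. z (\<sigma> i j)" z] by (simp add: case_prod_unfold)
  have "?S (\<lambda>z. f z + g z) = (\<lambda>ij. ?S f ij + ?S g ij)"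
    by (auto simp: pd_add assms algebra_simps)
  then show "total_deriv b \<sigma> (\<lambda>z. f z + g z) z = total_deriv b \<sigma> f z + total_deriv b \<sigma> g z"
    using Sum_any.distrib[OF fin[OF assms(1)] fin[OF assms(2)]]
    by (simp add: total_deriv_def pd_add assms)
qed

lemma total_deriv_mult:
  assumes "differential_function f" "differential_function g"
  shows "total_deriv b \<sigma> (\<lambda>z. f z * g z) = (\<lambda>z. total_deriv b \<sigma> f z * g z + f z * total_deriv b \<sigma> g z)"
proof
  fix z :: jet
  let ?S = "\<lambda>h (i, j). z (\<sigma> i j) * pd (Ju i j) h z"
  have fin: "finite {ij. ?S h ij \<noteq> 0}" if "differential_function h" for h
    using finite_pd_support[OF that, of "\<lambda>i j. z (\<sigma> i j)" z] by (simp add: case_prod_unfold)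
  have fin': "finite {ij. ?S f ij * g z \<noteq> 0}" "finite {ij. f z * ?S g ij \<noteq> 0}"
    by (rule finite_subset[OF _ fin[OF assms(1)]], force) (rule finite_subset[OF _ fin[OF assms(2)]], force)
  have "?S (\<lambda>z. f z * g z) = (\<lambda>ij. ?S f ij * g z + f z * ?S g ij)"
    by (auto simp: pd_mult assms algebra_simps)
  then show "total_deriv b \<sigma> (\<lambda>z. f z * g z) z = total_deriv b \<sigma> f z * g z + f z * total_deriv b \<sigma> g z"
    using Sum_any.distrib[OF fin'] Sum_any_left_distrib[OF fin[OF assms(1)], of "g z"]
      Sum_any_right_distrib[OF fin[OF assms(2)], of "f z"]
    by (simp add: total_deriv_def pd_mult assms algebra_simps)
qed

lemma total_deriv_const: "total_deriv b \<sigma> (\<lambda>z. a) = (\<lambda>z. 0)"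
  by (rule ext) (simp add: total_deriv_def pd_const case_prod_unfold)

lemma total_deriv_diff:
  assumes "differential_function f" "differential_function g"
  shows "total_deriv b \<sigma> (\<lambda>z. f z - g z) = (\<lambda>z. total_deriv b \<sigma> f z - total_deriv b \<sigma> g z)"
  using total_deriv_add[OF assms(1) differential_function_mult[OF differential_function_const[of "-1"] assms(2)], of b \<sigma>]
  unfolding total_deriv_mult[OF differential_function_const assms(2)] total_deriv_const
  by simp

lemma Sum_any_single: "Sum_any (\<lambda>(i, j). if i = k \<and> j = l then g i j else 0) = (g k l :: real)"
proof -
  have "Sum_any (\<lambda>(i, j). if i = k \<and> j = l then g i j else 0)
     = (\<Sum>ij \<in> {(k, l)}. case ij of (i, j) \<Rightarrow> if i = k \<and> j = l then g i j else 0)"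
    by (rule Sum_any.expand_superset) (auto split: if_splits)
  then show ?thesis by simp
qed

lemma total_deriv_coord: "b \<in> {Jt, Jx} \<Longrightarrow> total_deriv b \<sigma> (\<lambda>z. z (Ju k l)) = (\<lambda>z. z (\<sigma> k l))"
proof
  fix z :: jet
  have "(\<lambda>(i, j). z (\<sigma> i j) * (if i = k \<and> j = l then 1 else 0)) =
    (\<lambda>(i, j). if i = k \<and> j = l then z (\<sigma> i j) else 0)" by auto
  then show "b \<in> {Jt, Jx} \<Longrightarrow> total_deriv b \<sigma> (\<lambda>z. z (Ju k l)) z = z (\<sigma> k l)"
    using Sum_any_single[of k l "\<lambda>i j. z (\<sigma> i j)"]
    by (auto simp: total_deriv_def pd_coord)
qed

lemma total_deriv_lift:
  assumes "smooth f"
  shows "total_deriv b \<sigma> (lift f) = (\<lambda>z. pd b (lift f) z + z (\<sigma> 0 0) * lift (dU f) z)"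
proof
  fix z :: jet
  have "(\<lambda>(i, j). z (\<sigma> i j) * (if i = 0 \<and> j = 0 then lift (dU f) z else 0)) =
    (\<lambda>(i, j). if i = 0 \<and> j = 0 then z (\<sigma> i j) * lift (dU f) z else 0)" by auto
  then show "total_deriv b \<sigma> (lift f) z = pd b (lift f) z + z (\<sigma> 0 0) * lift (dU f) z"
    using Sum_any_single[of 0 0 "\<lambda>i j. z (\<sigma> i j) * lift (dU f) z"]
    by (auto simp: total_deriv_def pd_lift(3)[OF assms])
qed

lemma total_deriv_coords: "Dt (\<lambda>z. z (Ju k l)) = (\<lambda>z. z (Ju (Suc k) l))"
  "Dx (\<lambda>z. z (Ju k l)) = (\<lambda>z. z (Ju k (Suc l)))"
  by (simp_all add: total_deriv_eq total_deriv_coord)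

lemma Dt_lift: "smooth f \<Longrightarrow> Dt (lift f) = (\<lambda>z. lift (dT f) z + z (Ju (Suc 0) 0) * lift (dU f) z)"
  and Dx_lift: "smooth f \<Longrightarrow> Dx (lift f) = (\<lambda>z. lift (dX f) z + z (Ju 0 (Suc 0)) * lift (dU f) z)"
  by (simp_all add: total_deriv_eq total_deriv_lift pd_lift)

lemmas Dx_rules = total_deriv_add[of _ _ Jx "\<lambda>i j. Ju i (Suc j)", folded total_deriv_eq]
  total_deriv_diff[of _ _ Jx "\<lambda>i j. Ju i (Suc j)", folded total_deriv_eq]
  total_deriv_mult[of _ _ Jx "\<lambda>i j. Ju i (Suc j)", folded total_deriv_eq] total_deriv_coords(2)
  total_deriv_const[of Jx "\<lambda>i j. Ju i (Suc j)", folded total_deriv_eq]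

section \<open>Prolongation coefficients\<close>

lemma Dx_Dt_lift:
  assumes "smooth f"
  shows "Dx (Dt (lift f)) = (\<lambda>z. lift (dX (dT f)) z + z (Ju 0 1) * lift (dU (dT f)) z
     + z (Ju 1 1) * lift (dU f) z
     + z (Ju 1 0) * (lift (dX (dU f)) z + z (Ju 0 1) * lift (dU (dU f)) z))"
  by (simp add: Dt_lift Dx_lift Dx_rules differential_function_intros smooth_dir_deriv assms add.assoc)

lemma Dx_Dx_lift:
  assumes "smooth f"
  shows "Dx (Dx (lift f)) = (\<lambda>z. lift (dX (dX f)) z + z (Ju 0 1) * lift (dU (dX f)) z
     + z (Ju 0 2) * lift (dU f) z
     + z (Ju 0 1) * (lift (dX (dU f)) z + z (Ju 0 1) * lift (dU (dU f)) z))"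
  by (simp add: Dx_lift Dx_rules differential_function_intros smooth_dir_deriv assms numeral_2_eq_2 add.assoc)

lemma Dx_Dx_Dt_lift:
  assumes "smooth f"
  shows "Dx (Dx (Dt (lift f))) = (\<lambda>z. lift (dX (dX (dT f))) z + z (Ju 0 1) * lift (dU (dX (dT f))) z
     + z (Ju 0 2) * lift (dU (dT f)) z
     + z (Ju 0 1) * (lift (dX (dU (dT f))) z + z (Ju 0 1) * lift (dU (dU (dT f))) z)
     + z (Ju 1 2) * lift (dU f) z
     + 2 * z (Ju 1 1) * (lift (dX (dU f)) z + z (Ju 0 1) * lift (dU (dU f)) z)
     + z (Ju 1 0) * (lift (dX (dX (dU f))) z + z (Ju 0 1) * lift (dU (dX (dU f))) z
         + z (Ju 0 2) * lift (dU (dU f)) z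
         + z (Ju 0 1) * (lift (dX (dU (dU f))) z + z (Ju 0 1) * lift (dU (dU (dU f))) z)))"
  by (simp add: Dx_Dt_lift Dx_lift Dx_rules differential_function_intros smooth_dir_deriv assms
      numeral_2_eq_2) (simp add: algebra_simps)

lemma Dx_Dx_Dx_lift:
  assumes "smooth f"
  shows "Dx (Dx (Dx (lift f))) = (\<lambda>z. lift (dX (dX (dX f))) z + z (Ju 0 1) * lift (dU (dX (dX f))) z
     + z (Ju 0 2) * lift (dU (dX f)) z
     + z (Ju 0 1) * (lift (dX (dU (dX f))) z + z (Ju 0 1) * lift (dU (dU (dX f))) z)
     + z (Ju 0 3) * lift (dU f) z
     + 2 * z (Ju 0 2) * (lift (dX (dU f)) z + z (Ju 0 1) * lift (dU (dU f)) z)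
     + z (Ju 0 1) * (lift (dX (dX (dU f))) z + z (Ju 0 1) * lift (dU (dX (dU f))) z
         + z (Ju 0 2) * lift (dU (dU f)) z
         + z (Ju 0 1) * (lift (dX (dU (dU f))) z + z (Ju 0 1) * lift (dU (dU (dU f))) z)))"
  by (simp add: Dx_Dx_lift Dx_lift Dx_rules differential_function_intros smooth_dir_deriv assms
      numeral_2_eq_2 numeral_3_eq_3) (simp add: algebra_simps)

text \<open>The total derivative of a differential function in the above sense need not be differentiable
again. For lifted smooth functions it is, by the explicit formulas.\<close>

lemma differential_function_total_derivatives:
  assumes "smooth f"
  shows "differential_function (Dt (lift f))" "differential_function (Dx (lift f))"
    "differential_function (Dx (Dt (lift f)))" "differential_function (Dx (Dx (lift f)))"
  by (simp add: Dt_lift differential_function_intros smooth_dir_deriv assms)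
    (simp add: Dx_lift differential_function_intros smooth_dir_deriv assms,
      simp add: Dx_Dt_lift differential_function_intros smooth_dir_deriv assms,
      simp add: Dx_Dx_lift differential_function_intros smooth_dir_deriv assms)

text \<open>The prolongation coefficients are expanded here by the Leibniz rule, while the total
derivatives of \<open>\<tau>\<close>, \<open>\<xi>\<close> and \<open>\<eta>\<close> themselves are kept as units. The terms with derivatives of \<open>u\<close> of
order four cancel.\<close>

locale smooth_vfield =
  fixes \<tau> \<xi> \<eta> :: "point \<Rightarrow> real" and X :: vfield
  assumes smooth: "smooth \<tau>" "smooth \<xi>" "smooth \<eta>"
    and X_eq: "X = (\<lambda>p. (\<tau> p, \<xi> p, \<eta> p))"
begin

lemma components: "tau X = lift \<tau>" "xi X = lift \<xi>" "eta X = lift \<eta>"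
  by (auto simp: X_eq tau_def xi_def eta_def lift_def)

lemmas Leibniz_simps = components Dx_rules differential_function_intros
  differential_function_total_derivatives smooth

lemma zeta_t: "zeta X 1 0 = (\<lambda>z. Dt (lift \<eta>) z - Dt (lift \<tau>) z * z (Ju 1 0) - Dt (lift \<xi>) z * z (Ju 0 1))"
  by (simp add: components)

lemma zeta_x: "zeta X 0 1 = (\<lambda>z. Dx (lift \<eta>) z - Dx (lift \<tau>) z * z (Ju 1 0) - Dx (lift \<xi>) z * z (Ju 0 1))"
  by (simp add: components)

lemma zeta_xx: "zeta X 0 2 = (\<lambda>z. Dx (Dx (lift \<eta>)) z
    - Dx (Dx (lift \<tau>)) z * z (Ju 1 0) - 2 * Dx (lift \<tau>) z * z (Ju 1 1)
    - Dx (Dx (lift \<xi>)) z * z (Ju 0 1) - 2 * Dx (lift \<xi>) z * z (Ju 0 2))"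
  by (simp add: Leibniz_simps numeral_2_eq_2) (simp add: algebra_simps)

lemma zeta_xxx: "zeta X 0 3 = (\<lambda>z. Dx (Dx (Dx (lift \<eta>))) z
    - Dx (Dx (Dx (lift \<tau>))) z * z (Ju 1 0) - 3 * Dx (Dx (lift \<tau>)) z * z (Ju 1 1)
    - 3 * Dx (lift \<tau>) z * z (Ju 1 2)
    - Dx (Dx (Dx (lift \<xi>))) z * z (Ju 0 1) - 3 * Dx (Dx (lift \<xi>)) z * z (Ju 0 2)
    - 3 * Dx (lift \<xi>) z * z (Ju 0 3))"
proof -
  have "zeta X 0 3 = (\<lambda>z. Dx (zeta X 0 2) z - Dx (tau X) z * z (Ju 1 2) - Dx (xi X) z * z (Ju 0 3))"
    by (simp add: numeral_2_eq_2 numeral_3_eq_3)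
  then show ?thesis
    unfolding zeta_xx components
    by (simp add: Leibniz_simps numeral_2_eq_2 numeral_3_eq_3) (simp add: algebra_simps)
qed

lemma zeta_txx: "zeta X 1 2 = (\<lambda>z. Dx (Dx (Dt (lift \<eta>))) z
    - Dx (Dx (Dt (lift \<tau>))) z * z (Ju 1 0) - 2 * Dx (Dt (lift \<tau>)) z * z (Ju 1 1)
    - Dt (lift \<tau>) z * z (Ju 1 2) - Dx (Dx (lift \<tau>)) z * z (Ju 2 0) - 2 * Dx (lift \<tau>) z * z (Ju 2 1)
    - Dx (Dx (Dt (lift \<xi>))) z * z (Ju 0 1) - 2 * Dx (Dt (lift \<xi>)) z * z (Ju 0 2)
    - Dt (lift \<xi>) z * z (Ju 0 3) - Dx (Dx (lift \<xi>)) z * z (Ju 1 1) - 2 * Dx (lift \<xi>) z * z (Ju 1 2))"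
  by (simp add: Leibniz_simps numeral_2_eq_2 numeral_3_eq_3) (simp add: algebra_simps)

end

section \<open>The prolonged field applied to the equation\<close>

lemma pd_eqF:
  "pd Jt (eqF lam) z = 0"
  "pd Jx (eqF lam) z = 0"
  "pd (Ju 0 0) (eqF lam) z = lam - z (Ju 0 3) + 6 * z (Ju 0 0) * z (Ju 0 1)"
  "pd (Ju 1 0) (eqF lam) z = 1"
  "pd (Ju 0 1) (eqF lam) z = 3 * (z (Ju 0 0))\<^sup>2 - 2 * z (Ju 0 2)"
  "pd (Ju 0 2) (eqF lam) z = - lam - 2 * z (Ju 0 1)"
  "pd (Ju 0 3) (eqF lam) z = - z (Ju 0 0)"
  "pd (Ju 1 2) (eqF lam) z = - 1"
  "pd (Ju 1 1) (eqF lam) z = 0"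
  "pd (Ju 2 0) (eqF lam) z = 0"
  "pd (Ju 2 1) (eqF lam) z = 0"
  "pd (Ju 3 0) (eqF lam) z = 0"
  by (rule pdI, (auto simp: eqF_def Let_def intro!: derivative_eq_intros)[1])+

lemma jet_orders_le_3:
  "{(i, j). i + j \<le> (3::nat)} = {(0,0),(0,1),(0,2),(0,3),(1,0),(1,1),(1,2),(2,0),(2,1),(3,0)}"
proof -
  have "i + j \<le> 3 \<longleftrightarrow> i = 0 \<and> j = 0 \<or> i = 0 \<and> j = 1 \<or> i = 0 \<and> j = 2 \<or> i = 0 \<and> j = 3 \<or>
    i = 1 \<and> j = 0 \<or> i = 1 \<and> j = 1 \<or> i = 1 \<and> j = 2 \<or> i = 2 \<and> j = 0 \<or> i = 2 \<and> j = 1 \<or>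
    i = 3 \<and> j = 0" for i j :: nat
    by presburger
  then show ?thesis by (simp add: set_eq_iff)
qed

lemma prolong_eqF:
  "prolong 3 X (eqF lam) z = zeta X 1 0 z - zeta X 1 2 z + lam * (zeta X 0 0 z - zeta X 0 2 z)
    - zeta X 0 0 z * z (Ju 0 3) - z (Ju 0 0) * zeta X 0 3 z
    - 2 * zeta X 0 1 z * z (Ju 0 2) - 2 * z (Ju 0 1) * zeta X 0 2 z
    + 6 * z (Ju 0 0) * zeta X 0 0 z * z (Ju 0 1) + 3 * (z (Ju 0 0))\<^sup>2 * zeta X 0 1 z"
  unfolding prolong_def jet_orders_le_3
  by (simp add: pd_eqF pd_eqF[unfolded One_nat_def] del: zeta.simps One_nat_def) (simp add: algebra_simps)

text \<open>Solving the equation for \<open>u\<^sub>t\<^sub>x\<^sub>x\<close>, as it occurs linearly with coefficient \<open>-1\<close>, parametrises its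
solution set by the base point \<open>p\<close>, which also gives the value of \<open>u\<close>, and all other
derivatives \<open>v\<close>.\<close>

definition solution_jet :: "real \<Rightarrow> point \<Rightarrow> (nat \<Rightarrow> nat \<Rightarrow> real) \<Rightarrow> jet" where
  "solution_jet lam p v c = (case c of Jt \<Rightarrow> fst p | Jx \<Rightarrow> fst (snd p)
     | Ju i j \<Rightarrow> if i = 0 \<and> j = 0 then snd (snd p)
         else if i = 1 \<and> j = 2 then v 1 0 + lam * (snd (snd p) - v 0 2) - snd (snd p) * v 0 3
           - 2 * v 0 1 * v 0 2 + 3 * (snd (snd p))\<^sup>2 * v 0 1
         else v i j)"

lemma eqF_solution_jet: "eqF lam (solution_jet lam p v) = 0"
  by (simp add: eqF_def solution_jet_def)

lemma lift_solution_jet: "lift f (solution_jet lam p v) = f p"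
  by (simp add: lift_def base_def solution_jet_def)

section \<open>The determining equations\<close>

locale symmetry_generator = smooth_vfield +
  fixes lam :: real
  assumes symmetric: "lie_point_symmetry_generator lam X"
begin

lemma determining_equation: "prolong 3 X (eqF lam) (solution_jet lam p v) = 0"
  using symmetric eqF_solution_jet by (simp add: lie_point_symmetry_generator_def)

text \<open>The layers are unfolded from the highest total derivatives downwards, since rewriting an inner
total derivative first would hide the outer patterns.\<close>

lemmas determining_equation_expanded = determining_equation
  [unfolded prolong_eqF zeta_t zeta_x zeta_xx zeta_xxx zeta_txx zeta.simps(1) components,
   unfolded Dx_Dx_Dt_lift[OF smooth(1)] Dx_Dx_Dt_lift[OF smooth(2)] Dx_Dx_Dt_lift[OF smooth(3)]
     Dx_Dx_Dx_lift[OF smooth(1)] Dx_Dx_Dx_lift[OF smooth(2)] Dx_Dx_Dx_lift[OF smooth(3)],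
   unfolded Dx_Dt_lift[OF smooth(1)] Dx_Dt_lift[OF smooth(2)]
     Dx_Dx_lift[OF smooth(1)] Dx_Dx_lift[OF smooth(2)] Dx_Dx_lift[OF smooth(3)],
   unfolded Dx_lift[OF smooth(1)] Dx_lift[OF smooth(2)] Dx_lift[OF smooth(3)]
     Dt_lift[OF smooth(1)] Dt_lift[OF smooth(2)] Dt_lift[OF smooth(3)],
   unfolded lift_solution_jet]

text \<open>Jets with \<open>u\<^sub>x = q\<close> and \<open>u\<^sub>t\<^sub>t\<^sub>x = w\<close>: the last coordinate does not occur in the equation, and in the
symmetry condition it is multiplied by \<open>2 D\<^sub>x\<tau> = 2 (\<tau>\<^sub>x + q \<tau>\<^sub>u)\<close>.\<close>

lemma tau_time_only: "dX \<tau> = (\<lambda>p. 0)" "dU \<tau> = (\<lambda>p. 0)"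
proof -
  define v where "v q w = (\<lambda>(i :: nat) (j :: nat).
      if i = 0 \<and> j = 1 then q else if i = 2 \<and> j = 1 then w else (0 :: real))"
    for q w
  have "dX \<tau> p + q * dU \<tau> p = 0" for p q
  proof -
    note eq = determining_equation_expanded[of p "v q _"]
    show ?thesis
      using eq[of 0] eq[of 1]
      by (simp add: solution_jet_def v_def)
  qed
  from this[of _ 0] this[of _ 1] show "dX \<tau> = (\<lambda>p. 0)" "dU \<tau> = (\<lambda>p. 0)"
    by auto
qed

lemma tau_derivatives: "dX (dT \<tau>) = (\<lambda>p. 0)" "dU (dT \<tau>) = (\<lambda>p. 0)"
  using tau_time_only by (simp_all add: dir_deriv_dir_deriv_eq_0 smooth)

text \<open>Jets with \<open>u\<^sub>t = a\<close> and \<open>u\<^sub>x\<^sub>x\<^sub>x = r\<close>. The product \<open>a r\<close> arises only from the term \<open>D\<^sub>t\<xi> u\<^sub>x\<^sub>x\<^sub>x\<close> of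
\<open>\<zeta>\<^sup>t\<^sup>x\<^sup>x\<close>; the linear terms also collect what the substituted
\<open>u\<^sub>t\<^sub>x\<^sub>x = a - u r + \<lambda> u\<close> contributes.\<close>

lemma xi_independent_of_u: "dU \<xi> = (\<lambda>p. 0)"
  and eta_eq: "\<eta> = (\<lambda>p. dT \<xi> p + snd (snd p) * (dX \<xi> p - dT \<tau> p))"
  and eta_xxu: "dX (dX (dU \<eta>)) = (\<lambda>p. 2 * dX \<xi> p)"
proof -
  define v where "v a r = (\<lambda>(i :: nat) (j :: nat).
      if i = 1 \<and> j = 0 then a else if i = 0 \<and> j = 3 then r else (0 :: real))"
    for a r
  have eq: "a * (2 * dX \<xi> p - dX (dX (dU \<eta>)) p) + a * r * dU \<xi> p
      + r * (dT \<xi> p + snd (snd p) * (dX \<xi> p - dT \<tau> p) - \<eta> p) = 0" for a r p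
    using determining_equation_expanded[of p "v a r"]
      determining_equation_expanded[of p "v 0 0"]
    by (simp add: tau_time_only tau_derivatives dir_deriv_const)
      (simp add: solution_jet_def v_def algebra_simps)
  have t: "dX (dX (dU \<eta>)) p = 2 * dX \<xi> p" for p
    using eq[of 1 p 0] by simp
  have h: "\<eta> p = dT \<xi> p + snd (snd p) * (dX \<xi> p - dT \<tau> p)" for p
    using eq[of 0 p 1] by simp
  show "dU \<xi> = (\<lambda>p. 0)"
    using eq[of 1 _ 1] t h by auto
  show "\<eta> = (\<lambda>p. dT \<xi> p + snd (snd p) * (dX \<xi> p - dT \<tau> p))"
    using h by blast
  show "dX (dX (dU \<eta>)) = (\<lambda>p. 2 * dX \<xi> p)"
    using t by blast
qed

text \<open>Jets with \<open>u\<^sub>x = q\<close>. The difference of the conditions at \<open>q = 1\<close> and \<open>q = -1\<close> is twice the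
coefficient of \<open>q\<close>, as cubic terms are absent when \<open>\<xi>\<^sub>u = \<eta>\<^sub>u\<^sub>u = 0\<close>. With \<open>\<eta> = b + u a\<close> this
coefficient is a quadratic polynomial \<open>k + l u + m u\<^sup>2\<close> in \<open>u\<close> whose coefficients do not depend
on \<open>u\<close>, so each of them vanishes.\<close>

lemma xi_x_eq: "9 * dX \<xi> p = 3 * dT \<tau> p" (is ?xi_x)
  and xi_t_eq: "dX (dX (dX \<xi>)) p - 5 * dX (dX (dU \<eta>)) p + 6 * dT \<xi> p = 0" (is ?xi_t)
  and eta_u_eq: "dU \<eta> = (\<lambda>p. dX \<xi> p - dT \<tau> p)" (is ?eta_u)
proof -
  define a where "a = (\<lambda>p. dX \<xi> p - dT \<tau> p)"
  have a_at: "a p = dX \<xi> p - dT \<tau> p" for p by (simp add: a_def)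
  define b where "b = dT \<xi>"
  have smooth_ab: "smooth a" "smooth b"
    by (simp_all add: a_def b_def smooth_diff smooth_dir_deriv smooth)
  note smooth_all = smooth smooth_ab smooth_dir_deriv
  have eta: "\<eta> = (\<lambda>p. b p + snd (snd p) * a p)"
    using eta_eq by (simp add: a_def b_def)
  have u_xi: "dU \<xi> = (\<lambda>p. 0)" "dU (dX \<xi>) = (\<lambda>p. 0)" "dU (dT \<xi>) = (\<lambda>p. 0)"
     "dU (dX (dX \<xi>)) = (\<lambda>p. 0)" "dU (dX (dX (dX \<xi>))) = (\<lambda>p. 0)"
    by (simp_all add: xi_independent_of_u dir_deriv_dir_deriv_eq_0 smooth_all)
  have u_b: "dU b = (\<lambda>p. 0)" "dU (dX b) = (\<lambda>p. 0)" "dU (dT b) = (\<lambda>p. 0)"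
     "dU (dX (dX b)) = (\<lambda>p. 0)" "dU (dX (dT b)) = (\<lambda>p. 0)"
    by (simp_all add: b_def u_xi dir_deriv_dir_deriv_eq_0 smooth_all)
  have "dU a = (\<lambda>p. 0)"
    by (simp add: a_def dir_deriv_diff smooth_all u_xi tau_derivatives)
  then have u_a: "dU a = (\<lambda>p. 0)" "dU (dX a) = (\<lambda>p. 0)" "dU (dT a) = (\<lambda>p. 0)"
     "dU (dX (dX a)) = (\<lambda>p. 0)" "dU (dX (dT a)) = (\<lambda>p. 0)"
    by (simp_all add: dir_deriv_dir_deriv_eq_0 smooth_all)
  define v where "v q = (\<lambda>(i :: nat) (j :: nat). if i = 0 \<and> j = 1 then q else (0 :: real))"
    for q
  define k where "k p = - b p - 2 * dX (dT a) p - dX (dX b) p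
     - lam * (2 * dX a p - dX (dX \<xi>) p)" for p
  define l where "l p = dX (dX (dX \<xi>)) p - 5 * dX (dX a) p + 6 * b p" for p
  \<comment> \<open>The terms from \<open>3 u\<^sup>2 u\<^sub>x\<close> add up to \<open>m = 3 (\<tau>\<^sub>t + 2 \<xi>\<^sub>x - a) + 6 a + 3 (a - \<xi>\<^sub>x)\<close>, in which \<open>a\<close> is expanded.\<close>
  define m where "m p = 9 * dX \<xi> p - 3 * dT \<tau> p" for p
  have eq: "k p + snd (snd p) * l p + (snd (snd p))\<^sup>2 * m p = 0" for p
    using determining_equation_expanded[of p "v 1"] determining_equation_expanded[of p "v (- 1)"]
    by (simp add: eta b_def[symmetric] dir_deriv_affine_in_u smooth_all u_xi u_a u_b
          tau_time_only tau_derivatives dir_deriv_const)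
      (simp add: solution_jet_def v_def algebra_simps power2_eq_square k_def l_def m_def a_at)
  obtain t x u where p: "p = (t, x, u)" by (cases p)
  have inv: "g (t, x, w) = g (t, x, 0)" if "g \<in> {k, l, m}" for g w
    using that by (auto simp: k_def l_def m_def
        independent_of_u[of b t x w] independent_of_u[of "dX \<xi>" t x w] independent_of_u[of "dT \<tau>" t x w]
        independent_of_u[of "dX (dT a)" t x w]
        independent_of_u[of "dX a" t x w] independent_of_u[of "dX (dX \<xi>)" t x w]
        independent_of_u[of "dX (dX b)" t x w] independent_of_u[of "dX (dX a)" t x w]
        independent_of_u[of "dX (dX (dX \<xi>))" t x w] smooth_all u_xi u_a u_b tau_derivatives)
  \<comment> \<open>A quadratic polynomial with the zeros \<open>0\<close>, \<open>1\<close> and \<open>-1\<close> has vanishing coefficients.\<close>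
  from eq[of "(t, x, 0)"] eq[of "(t, x, 1)"] eq[of "(t, x, - 1)"]
  have "l (t, x, 0) = 0" "m (t, x, 0) = 0"
    by (simp_all add: inv[of _ 1] inv[of _ "- 1"])
  then have lm: "l p = 0" "m p = 0"
    using p inv[of l u] inv[of m u] by simp_all
  have eta_u: "dU \<eta> = a"
    by (simp add: eta dir_deriv_affine_in_u smooth_all u_a u_b)
  show ?xi_x using lm by (simp add: m_def)
  show ?xi_t using lm by (simp add: l_def eta_u b_def)
  show ?eta_u using eta_u by (simp add: a_def)
qed

text \<open>By the preceding lemma \<open>\<eta>\<^sub>u = -2/3 \<tau>\<^sub>t\<close> is a function of \<open>t\<close> alone, so \<open>2 \<xi>\<^sub>x = \<eta>\<^sub>x\<^sub>x\<^sub>u\<close> vanishes; the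
rest follows by substitution.\<close>

lemma xi_x_eq_0: "dX \<xi> = (\<lambda>p. 0)"
  and tau_t_eq_0: "dT \<tau> = (\<lambda>p. 0)"
  and xi_t_eq_0: "dT \<xi> = (\<lambda>p. 0)"
proof -
  have "dU \<eta> p = - 2 / 3 * dT \<tau> p" for p
    using xi_x_eq[of p] by (simp add: eta_u_eq)
  then have "dU \<eta> = (\<lambda>p. - 2 / 3 * dT \<tau> p)"
    by blast
  then have "dX (dU \<eta>) = (\<lambda>p. - 2 / 3 * dX (dT \<tau>) p)"
    by (simp only: dir_deriv_cmult smooth smooth_dir_deriv)
  then have "dX (dU \<eta>) = (\<lambda>p. 0)"
    by (simp add: tau_derivatives)
  then have xxu: "dX (dX (dU \<eta>)) = (\<lambda>p. 0)"
    by (simp add: dir_deriv_const)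
  show x: "dX \<xi> = (\<lambda>p. 0)"
    using xxu by (simp add: eta_xxu fun_eq_iff)
  show "dT \<tau> = (\<lambda>p. 0)"
    using xi_x_eq by (simp add: x fun_eq_iff)
  show "dT \<xi> = (\<lambda>p. 0)"
    using xi_t_eq by (simp add: x xxu dir_deriv_const fun_eq_iff)
qed

lemma translation_generator: "\<exists>a b. X = (\<lambda>p. a *\<^sub>R X1 p + b *\<^sub>R X2 p)"
proof -
  have "\<tau> p = \<tau> q" "\<xi> p = \<xi> q" for p q
    by (rule gradient_0_imp_const; simp add: smooth tau_time_only
         tau_t_eq_0 xi_independent_of_u xi_x_eq_0 xi_t_eq_0)+
  moreover have "\<eta> p = 0" for p
    using eta_eq by (simp add: xi_t_eq_0 xi_x_eq_0 tau_t_eq_0)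
  ultimately have "X = (\<lambda>p. \<tau> 0 *\<^sub>R X1 p + \<xi> 0 *\<^sub>R X2 p)"
    by (auto simp: X_eq X1_def X2_def fun_eq_iff)
  then show ?thesis by blast
qed

end

section \<open>The translations are symmetries\<close>

lemma zeta_constant_vfield:
  assumes "X = (\<lambda>p. (a, b, 0))"
  shows "zeta X i j = (\<lambda>z. 0)"
proof -
  have comp: "tau X = (\<lambda>z. a)" "xi X = (\<lambda>z. b)" "eta X = (\<lambda>z. 0)"
    by (auto simp: assms tau_def xi_def eta_def)
  have D: "Dt (\<lambda>z. c) = (\<lambda>z. 0)" "Dx (\<lambda>z. c) = (\<lambda>z. 0)" for c
    by (simp_all add: total_deriv_eq total_deriv_const)
  have i: "zeta X i 0 = (\<lambda>z. 0)" for i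
    by (induction i) (simp_all add: comp D)
  show ?thesis
    by (induction j) (simp_all add: i comp D)
qed

lemma constant_vfield_symmetry: "lie_point_symmetry_generator lam (\<lambda>p. (a, b, 0))"
  by (auto simp: lie_point_symmetry_generator_def smooth_const prolong_def
      zeta_constant_vfield[OF refl] pd_eqF intro!: sum.neutral)

lemma one_parameter_group_translation:
  assumes "\<And>\<epsilon> p. \<phi> \<epsilon> p = p + \<epsilon> *\<^sub>R v"
  shows "one_parameter_group \<phi> (\<lambda>p. v)"
proof -
  have "bounded_linear (\<lambda>q :: real \<times> point. snd q + fst q *\<^sub>R v)"
    by (intro bounded_linear_add bounded_linear_snd bounded_linear_fst
        bounded_linear_scaleR_left[THEN bounded_linear_compose])
  then have "smooth (\<lambda>(\<epsilon>, p). \<phi> \<epsilon> p)"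
    by (simp add: smooth_bounded_linear assms case_prod_unfold)
  moreover have "((\<lambda>\<epsilon>. \<phi> \<epsilon> p) has_vector_derivative v) (at 0)" for p
    unfolding assms by (auto intro!: derivative_eq_intros)
  ultimately show ?thesis
    by (simp add: one_parameter_group_def assms algebra_simps)
qed

theorem theorem3p1:
  fixes lam :: real
  shows "{X. lie_point_symmetry_generator lam X}
           = {X. \<exists>a b. X = (\<lambda>p. a *\<^sub>R X1 p + b *\<^sub>R X2 p)}
         \<and> one_parameter_group (\<lambda>\<epsilon> (t, x, u). (t + \<epsilon>, x, u)) X1
         \<and> one_parameter_group (\<lambda>\<epsilon> (t, x, u). (t, x + \<epsilon>, u)) X2"
proof (intro conjI set_eqI iffI; (elim CollectE exE)?)
  fix X assume X: "lie_point_symmetry_generator lam X"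
  then have "smooth X" by (simp add: lie_point_symmetry_generator_def)
  then interpret symmetry_generator "\<lambda>p. fst (X p)" "\<lambda>p. fst (snd (X p))" "\<lambda>p. snd (snd (X p))" X lam
    using X by unfold_locales (auto intro!: smooth_bounded_linear_comp[of fst]
        smooth_bounded_linear_comp[of "\<lambda>q. fst (snd q)"] smooth_bounded_linear_comp[of "\<lambda>q. snd (snd q)"]
        bounded_linear_fst_comp bounded_linear_snd_comp bounded_linear_fst bounded_linear_snd)
  show "X \<in> {X. \<exists>a b. X = (\<lambda>p. a *\<^sub>R X1 p + b *\<^sub>R X2 p)}"
    using translation_generator by blast
next
  fix X :: vfield and a b
  assume "X = (\<lambda>p. a *\<^sub>R X1 p + b *\<^sub>R X2 p)"
  then have "X = (\<lambda>p. (a, b, 0))"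
    by (simp add: X1_def X2_def)
  then show "X \<in> {X. lie_point_symmetry_generator lam X}"
    by (simp add: constant_vfield_symmetry)
next
  show "one_parameter_group (\<lambda>\<epsilon> (t, x, u). (t + \<epsilon>, x, u)) X1"
    unfolding X1_def by (rule one_parameter_group_translation) auto
  show "one_parameter_group (\<lambda>\<epsilon> (t, x, u). (t, x + \<epsilon>, u)) X2"
    unfolding X2_def by (rule one_parameter_group_translation) auto
qed

end
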